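(* Let $M\in\mathbb{R}^{n\times n}$ be symmetric positive definite, let $d\in\mathbb{R}^n_{++}$ be given, and let $D=\operatorname{Diag}(d)$. Let $x_1$ and $x_n$ denote (right) eigenvectors of $MD$ for its largest and smallest eigenvalue, respectively. Then the gradient of the composite function $\kappa(d)=\lambda_{\max}(MD)/\lambda_{\min}(MD)$ is $$\nabla\kappa(d)=\kappa(d)\left(\frac{1}{x_1^TDx_1}\,(x_1\bullet x_1)-\frac{1}{x_n^TDx_n}\,(x_n\bullet x_n)\right).$$ Hence, $M$ is $\kappa$-optimally diagonally preconditioned if, and only if, the orthonormal eigenvector pair $x_1,x_n$ (of $M$, i.e. with $d$ the all-ones vector) satisfies $$x_1\bullet x_1=x_n\bullet x_n .$$ Equivalently, after a permutation of the elements to account for the sign, $$x_1=\begin{pmatrix}u\\ v\end{pmatrix},\qquad x_n=\begin{pmatrix}u\\ -v\end{pmatrix},\qquad \|u\|=\|v\| .$$ In the nonsmooth case, we can choose the normalized $x_1$, respectively $x_n$, in the eigenspace of $\lambda_{\max}(MD)$, respectively $\lambda_{\min}(MD)$.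
   Context: $\mathbb{R}^n_{++}$ is the set of vectors with strictly positive entries; $\operatorname{Diag}(d)$ is the diagonal matrix with diagonal $d$; $\bullet$ is the Hadamard (elementwise) product. For $M$ symmetric positive definite and $d\in\mathbb{R}^n_{++}$, the (generally nonsymmetric) matrix $M\operatorname{Diag}(d)$ has real positive eigenvalues, the same as those of $\operatorname{Diag}(d)^{1/2}M\operatorname{Diag}(d)^{1/2}$; $\lambda_{\max},\lambda_{\min}$ denote its largest and smallest eigenvalues, and $\kappa(d):=\lambda_{\max}(M\operatorname{Diag}(d))/\lambda_{\min}(M\operatorname{Diag}(d))$. $M$ is called $\kappa$-optimally diagonally preconditioned if the all-ones vector is a minimizer of $\kappa$ over $\mathbb{R}^n_{++}$, i.e. no positive diagonal scaling $\operatorname{Diag}(d)^{1/2}M\operatorname{Diag}(d)^{1/2}$ has a smaller ratio of largest to smallest eigenvalue than $M$. The smooth setting is the one where the largest and smallest eigenvalues have multiplicity one; the nonsmooth case is the remaining one.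
   Formalization: Nonsmooth case: "optimal iff x1, xn can be chosen with equal squares" fails (M=2I-J/3, n=3); proved: such a choice implies optimality, and optimality iff the convex hulls of squared unit eigenvectors meet; the gradient formula is then a Clarke generalized gradient. *)

theory Defs
  imports "HOL-Analysis.Analysis"
begin

text \<open>The type \<open>real^'n\<close> carries componentwise multiplication and the constant-one vector, so
  \<open>x * y\<close> is the Hadamard product and \<open>1\<close> is the all-ones vector.\<close>

definition sym_pos_def :: "real^'n^'n \<Rightarrow> bool" where
  "sym_pos_def M \<longleftrightarrow> transpose M = M \<and> (\<forall>x. x \<noteq> 0 \<longrightarrow> x \<bullet> (M *v x) > 0)"

definition pos_vec :: "real^'n \<Rightarrow> bool" where
  "pos_vec d \<longleftrightarrow> (\<forall>i. d $ i > 0)"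

definition Diag :: "real^'n \<Rightarrow> real^'n^'n" where
  "Diag d = (\<chi> i j. if i = j then d $ i else 0)"

definition eigenvector :: "real^'n^'n \<Rightarrow> real \<Rightarrow> real^'n \<Rightarrow> bool" where
  "eigenvector A l x \<longleftrightarrow> x \<noteq> 0 \<and> A *v x = l *\<^sub>R x"

definition unit_eigenvector :: "real^'n^'n \<Rightarrow> real \<Rightarrow> real^'n \<Rightarrow> bool" where
  "unit_eigenvector A l x \<longleftrightarrow> eigenvector A l x \<and> norm x = 1"

text \<open>Only real eigenvalues are collected. The matrices of interest, \<open>M ** Diag d\<close> with \<open>M\<close>
  symmetric positive definite and \<open>d\<close> positive, are similar to symmetric matrices, so their whole
  spectrum is real (and nonempty).\<close>

definition eigenvalues :: "real^'n^'n \<Rightarrow> real set" where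
  "eigenvalues A = {l. \<exists>x. eigenvector A l x}"

definition lambda_max :: "real^'n^'n \<Rightarrow> real" where
  "lambda_max A = Max (eigenvalues A)"

definition lambda_min :: "real^'n^'n \<Rightarrow> real" where
  "lambda_min A = Min (eigenvalues A)"

text \<open>Geometric multiplicity; it agrees with the algebraic one for the (diagonalizable) matrices
  \<open>M ** Diag d\<close>.\<close>

definition multiplicity_of :: "real^'n^'n \<Rightarrow> real \<Rightarrow> nat" where
  "multiplicity_of A l = dim {x. A *v x = l *\<^sub>R x}"

definition smooth_case :: "real^'n^'n \<Rightarrow> bool" where
  "smooth_case A \<longleftrightarrow> multiplicity_of A (lambda_max A) = 1 \<and> multiplicity_of A (lambda_min A) = 1"

definition kappa :: "real^'n^'n \<Rightarrow> real^'n \<Rightarrow> real" where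
  "kappa M d = lambda_max (M ** Diag d) / lambda_min (M ** Diag d)"

definition kappa_optimal :: "real^'n^'n \<Rightarrow> bool" where
  "kappa_optimal M \<longleftrightarrow> is_arg_min (kappa M) pos_vec 1"

definition kappa_grad :: "real^'n^'n \<Rightarrow> real^'n \<Rightarrow> real^'n \<Rightarrow> real^'n \<Rightarrow> real^'n" where
  "kappa_grad M d x1 xn = kappa M d *\<^sub>R
     ((1 / (x1 \<bullet> (Diag d *v x1))) *\<^sub>R (x1 * x1) - (1 / (xn \<bullet> (Diag d *v xn))) *\<^sub>R (xn * xn))"

text \<open>The list \<open>is\<close> enumerates the coordinates in permuted order; the lists \<open>u\<close> and \<open>v\<close> are the
  two blocks, whose lengths add up to the dimension.\<close>

definition list_norm :: "real list \<Rightarrow> real" where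
  "list_norm u = sqrt (\<Sum>t\<leftarrow>u. t\<^sup>2)"

definition sign_block_form :: "real^'n \<Rightarrow> real^'n \<Rightarrow> bool" where
  "sign_block_form x1 xn \<longleftrightarrow>
     (\<exists>is u v. distinct is \<and> set is = UNIV \<and>
        map (($) x1) is = u @ v \<and> map (($) xn) is = u @ map uminus v \<and>
        list_norm u = list_norm v)"

text \<open>Clarke's generalized directional derivative and generalized gradient.\<close>

definition clarke_dd :: "('a::real_inner \<Rightarrow> real) \<Rightarrow> 'a \<Rightarrow> 'a \<Rightarrow> ereal" where
  "clarke_dd f x h =
     Limsup (nhds x \<times>\<^sub>F at_right (0::real)) (\<lambda>(y, t). ereal ((f (y + t *\<^sub>R h) - f y) / t))"

definition clarke_gradient :: "('a::real_inner \<Rightarrow> real) \<Rightarrow> 'a \<Rightarrow> 'a set" where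
  "clarke_gradient f x = {g. \<forall>h. ereal (g \<bullet> h) \<le> clarke_dd f x h}"

text \<open>In an eigenspace of dimension at least two, the set of squares of unit eigenvectors need not
  be convex, and optimality of \<open>M\<close> only says that the convex hulls for the two extreme eigenvalues
  meet. For \<open>M = 2I - J/3\<close> in dimension 3 (\<open>J\<close> all ones; eigenvalues 2, 2, 1) the all-ones vector
  minimizes \<open>kappa M\<close> by symmetry, but no unit eigenvectors \<open>x1\<close> for 2 and \<open>xn\<close> for 1 satisfy
  \<open>x1 * x1 = xn * xn\<close>, since three signs cannot sum to 0.\<close>

definition eigen_squares :: "real^'n^'n \<Rightarrow> real \<Rightarrow> (real^'n) set" where
  "eigen_squares A l = {x * x | x. unit_eigenvector A l x}"

end

theory Submission
  imports Defs
begin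

text \<open>Writing \<open>M D x = l x\<close> as \<open>D x = l M\<^sup>-\<^sup>1 x\<close> turns the Rayleigh quotient into
  \<open>(x \<bullet> D x) / (x \<bullet> M\<^sup>-\<^sup>1 x)\<close>, which is linear in \<open>d\<close>. So the extreme eigenvalues of \<open>M D\<close> are the
  maximum and the minimum of \<open>d \<bullet> k\<close> over a compact set of vectors \<open>k = x * x\<close> that does not depend
  on \<open>d\<close>. Danskin's theorem then gives the gradient. Globally, \<open>kappa M\<close> is a convex function over a
  concave one, so optimality at the all-ones vector is a first-order condition, which by separation
  says that the convex hulls of the two sets of squared unit eigenvectors meet.\<close>

section \<open>Hadamard products and positive vectors\<close>

lemma Diag_mult_vec: "Diag d *v x = d * x"
  by (simp add: vec_eq_iff Diag_def matrix_vector_mult_def if_distrib if_distribR sum.delta' cong: if_cong)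

lemma Diag_one: "M ** Diag 1 = M"
proof -
  have "Diag 1 = (mat 1 :: real^'a^'a)"
    by (simp add: Diag_def mat_def vec_eq_iff)
  then show ?thesis by simp
qed

lemma inner_times_vec: "x \<bullet> (d * x) = d \<bullet> (x * (x::real^'n))"
  by (simp add: inner_vec_def mult_ac)

lemma inner_one_square: "1 \<bullet> (x * (x::real^'n)) = (norm x)\<^sup>2"
  by (simp add: inner_vec_def power2_norm_eq_inner)

lemma scaleR_times_scaleR_vec: "(a *\<^sub>R x) * (a *\<^sub>R x) = a\<^sup>2 *\<^sub>R (x * (x::real^'n))"
  by (simp add: vec_eq_iff power2_eq_square mult_ac)

lemma continuous_on_times_vec [continuous_intros]:
  "continuous_on S (\<lambda>x. x * (x::real^'n))"
  unfolding times_vec_def by (intro continuous_intros)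

lemma pos_vec_inner_square_pos:
  assumes "pos_vec d" "x \<noteq> 0"
  shows "d \<bullet> (x * x) > 0"
proof -
  obtain i where i: "x $ i \<noteq> 0" using assms(2) by (auto simp: vec_eq_iff)
  have dp: "d $ j > 0" for j using assms(1) by (simp add: pos_vec_def)
  have "(\<Sum>j\<in>UNIV. d $ j * (x $ j * x $ j)) > 0"
    by (rule sum_pos2[of _ i]) (use dp i in \<open>auto simp: mult_pos_pos less_imp_le zero_less_mult_iff\<close>)
  then show ?thesis by (simp add: inner_vec_def)
qed

lemma eventually_pos_vec:
  assumes "pos_vec d"
  shows "\<forall>\<^sub>F y in nhds d. pos_vec y"
proof -
  have "{y::real^'n. pos_vec y} = (\<Inter>i\<in>UNIV. {y. y $ i > 0})"
    by (auto simp: pos_vec_def)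
  moreover have "open (\<Inter>i\<in>(UNIV::'n set). {y::real^'n. y $ i > 0})"
    by (intro open_INT) (auto intro!: open_Collect_less continuous_intros)
  ultimately show ?thesis
    using assms by (metis eventually_nhds mem_Collect_eq)
qed

lemma pos_vec_one: "pos_vec 1"
  by (simp add: pos_vec_def)

section \<open>Semidefinite quadratic forms and the inverse of a positive definite matrix\<close>

lemma inner_matrix_vector_sym:
  fixes A :: "real^'n^'n"
  assumes "transpose A = A"
  shows "x \<bullet> (A *v y) = y \<bullet> (A *v x)"
  by (metis assms dot_lmul_matrix inner_commute transpose_matrix_vector)

text \<open>The form attains its minimum 0 at \<open>p\<close>. If \<open>A *v p\<close> were
  nonzero, a small step from \<open>p\<close> against it would make the form negative to first
  order.\<close>

lemma psd_quadratic_zero: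
  fixes A :: "real^'n^'n"
  assumes sym: "transpose A = A" and psd: "\<And>x. x \<bullet> (A *v x) \<ge> 0" and p: "p \<bullet> (A *v p) = 0"
  shows "A *v p = 0"
proof -
  define y where "y = A *v p"
  define b where "b = y \<bullet> (A *v y)"
  have "y \<bullet> y \<le> 0"
  proof (rule ccontr)
    assume "\<not> y \<bullet> y \<le> 0"
    then have yy: "y \<bullet> y > 0" by (simp only: not_le)
    have b: "b \<ge> 0" using psd b_def by simp
    \<comment> \<open>The value at \<open>p + t *\<^sub>R y\<close> is
      \<open>t * (2 * (y \<bullet> y) + t * b)\<close>. It is negative as soon as
      \<open>t < 0\<close> and \<open>t * b \<ge> - (y \<bullet> y)\<close>; the summand 1 covers
      \<open>b = 0\<close>.\<close>
    define t where "t = - (y \<bullet> y) / (b + 1)"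
    have "(p + t *\<^sub>R y) \<bullet> (A *v (p + t *\<^sub>R y)) \<ge> 0" by (rule psd)
    moreover have "p \<bullet> (A *v y) = y \<bullet> y"
      using inner_matrix_vector_sym[OF sym, of p y] by (simp add: y_def)
    ultimately have "2 * t * (y \<bullet> y) + t * t * b \<ge> 0"
      using p by (simp add: matrix_vector_right_distrib inner_add_left inner_add_right
          matrix_vector_mult_scaleR y_def[symmetric] b_def[symmetric] algebra_simps)
    moreover have "t < 0" using yy b by (simp add: t_def divide_neg_pos)
    ultimately have "2 * (y \<bullet> y) + t * b \<le> 0"
      using zero_le_mult_iff[of t "2 * (y \<bullet> y) + t * b"] by (simp add: algebra_simps)
    moreover have "t * b = - ((y \<bullet> y) * (b / (b + 1)))" by (simp add: t_def)
    moreover have "(y \<bullet> y) * (b / (b + 1)) \<le> y \<bullet> y"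
      using b yy by (intro mult_left_le) auto
    ultimately show False using yy by linarith
  qed
  then show ?thesis unfolding y_def by (metis inner_gt_zero_iff not_le)
qed

lemma sym_pos_def_matrix_inv:
  assumes "sym_pos_def M"
  shows "M ** matrix_inv M = mat 1" "matrix_inv M ** M = mat 1" "sym_pos_def (matrix_inv M)"
proof -
  have sym: "transpose M = M" and pos: "\<And>x. x \<noteq> 0 \<Longrightarrow> x \<bullet> (M *v x) > 0"
    using assms by (auto simp: sym_pos_def_def)
  have "x = 0" if "M *v x = 0" for x
    using pos[of x] that by fastforce
  then have "invertible M"
    by (metis invertible_left_inverse matrix_left_invertible_ker)
  then have "\<exists>N. M ** N = mat 1 \<and> N ** M = mat 1" by (simp add: invertible_def)
  then have "M ** matrix_inv M = mat 1 \<and> matrix_inv M ** M = mat 1"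
    unfolding matrix_inv_def by (rule someI_ex)
  then show M: "M ** matrix_inv M = mat 1" "matrix_inv M ** M = mat 1" by auto
  let ?N = "matrix_inv M"
  have MN: "M *v (?N *v x) = x" for x
    by (simp add: matrix_vector_mul_assoc M)
  \<comment> \<open>By symmetry of \<open>M\<close> the transposed inverse is a left inverse too,
    hence equal to the inverse.\<close>
  have "transpose ?N ** M = mat 1"
    by (metis M(1) matrix_transpose_mul sym transpose_mat)
  then have "transpose ?N = ?N"
    by (metis M(1) matrix_mul_assoc matrix_mul_lid matrix_mul_rid)
  moreover have "x \<bullet> (?N *v x) > 0" if "x \<noteq> 0" for x
  proof -
    have "?N *v x \<noteq> 0" using MN[of x] that by auto
    from pos[OF this] show ?thesis by (simp add: MN inner_commute)
  qed
  ultimately show "sym_pos_def ?N" by (simp add: sym_pos_def_def)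
qed

section \<open>Squares of the points of an ellipsoid\<close>

text \<open>The points \<open>x\<close> form the ellipsoid on which the denominator of the Rayleigh
  quotient is 1. Keeping only their squares turns the numerator into the linear function
  \<open>d \<bullet> k\<close>.\<close>

definition energy_squares :: "real^'n^'n \<Rightarrow> (real^'n) set" where
  "energy_squares M = {x * x | x. x \<bullet> (matrix_inv M *v x) = 1}"

text \<open>The form is homogeneous of degree two, so dividing \<open>x\<close> by the square root
  of its energy puts it on the ellipsoid, and its square is divided by the energy itself.
  Inequalities over \<open>energy_squares M\<close> thereby extend to all nonzero vectors.\<close>

lemma energy_normalize:
  fixes x :: "real^'n"
  assumes M: "sym_pos_def M" and x: "x \<noteq> 0"
  shows "x \<bullet> (matrix_inv M *v x) > 0"
    and "(1 / (x \<bullet> (matrix_inv M *v x))) *\<^sub>R (x * x) \<in> energy_squares M"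
proof -
  show pos: "x \<bullet> (matrix_inv M *v x) > 0"
    using sym_pos_def_matrix_inv(3)[OF M] x by (simp add: sym_pos_def_def)
  define a where "a = 1 / sqrt (x \<bullet> (matrix_inv M *v x))"
  have a: "a\<^sup>2 = 1 / (x \<bullet> (matrix_inv M *v x))"
    using pos by (simp add: a_def power_divide)
  have "(a *\<^sub>R x) \<bullet> (matrix_inv M *v (a *\<^sub>R x)) = a\<^sup>2 * (x \<bullet> (matrix_inv M *v x))"
    by (simp add: matrix_vector_mult_scaleR power2_eq_square)
  also have "\<dots> = 1" using pos by (simp add: a)
  finally show "(1 / (x \<bullet> (matrix_inv M *v x))) *\<^sub>R (x * x) \<in> energy_squares M"
    unfolding energy_squares_def a[symmetric] scaleR_times_scaleR_vec[symmetric] by blast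
qed

lemma energy_squares_nonempty:
  assumes "sym_pos_def M"
  shows "energy_squares M \<noteq> {}"
  using energy_normalize(2)[OF assms, of 1] by auto

text \<open>The ellipsoid is closed, and it is bounded because the form is at least its minimum on
  the unit sphere times the squared norm. Squaring is continuous.\<close>

lemma compact_energy_squares:
  fixes M :: "real^'n^'n"
  assumes M: "sym_pos_def M"
  shows "compact (energy_squares M)"
proof -
  let ?q = "\<lambda>x::real^'n. x \<bullet> (matrix_inv M *v x)"
  have cont: "continuous_on S ?q" for S
    by (intro continuous_intros matrix_vector_mult_linear_continuous_on)
  have "sphere (0::real^'n) 1 \<noteq> {}" by simp
  from continuous_attains_inf[OF compact_sphere this cont]
  obtain m where m: "m \<in> sphere 0 1" "\<And>y. y \<in> sphere 0 1 \<Longrightarrow> ?q m \<le> ?q y"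
    by blast
  have "m \<noteq> 0" using m(1) by auto
  then have pos: "?q m > 0" using energy_normalize(1)[OF M] by simp
  have bound: "norm x \<le> 1 / sqrt (?q m)" if "?q x = 1" for x
  proof -
    have x0: "x \<noteq> 0" using that by auto
    have "?q m \<le> ?q ((1 / norm x) *\<^sub>R x)" by (rule m(2)) (use x0 in simp)
    also have "\<dots> = 1 / (norm x)\<^sup>2"
      using that by (simp add: matrix_vector_mult_scaleR power2_eq_square)
    finally have "(norm x)\<^sup>2 \<le> 1 / ?q m" using pos x0 by (simp add: field_simps)
    from real_le_rsqrt[OF this] show ?thesis by (simp add: real_sqrt_divide)
  qed
  have "bounded {x. ?q x = 1}"
    unfolding bounded_iff using bound by blast
  moreover have "closed {x. ?q x = 1}"
    by (intro closed_Collect_eq cont continuous_on_const)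
  ultimately have "compact ((\<lambda>x. x * x) ` {x. ?q x = 1})"
    by (intro compact_continuous_image continuous_on_times_vec) (simp add: compact_eq_bounded_closed)
  moreover have "energy_squares M = (\<lambda>x. x * x) ` {x. ?q x = 1}"
    by (auto simp: energy_squares_def)
  ultimately show ?thesis by simp
qed

section \<open>Extreme eigenvalues as extreme values of a linear function\<close>

text \<open>Applying the inverse of \<open>M\<close> turns the nonsymmetric eigenvalue problem into
  a generalized one for two symmetric matrices, \<open>Diag d\<close> and
  \<open>matrix_inv M\<close>.\<close>

lemma eigenvector_Diag_iff:
  fixes M :: "real^'n^'n"
  assumes M: "sym_pos_def M"
  shows "eigenvector (M ** Diag d) l x \<longleftrightarrow> x \<noteq> 0 \<and> d * x = l *\<^sub>R (matrix_inv M *v x)"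
proof -
  have "M *v (d * x) = l *\<^sub>R x \<longleftrightarrow> d * x = l *\<^sub>R (matrix_inv M *v x)"
  proof
    assume "M *v (d * x) = l *\<^sub>R x"
    then have "matrix_inv M *v (M *v (d * x)) = l *\<^sub>R (matrix_inv M *v x)"
      by (simp add: matrix_vector_mult_scaleR)
    then show "d * x = l *\<^sub>R (matrix_inv M *v x)"
      by (simp add: matrix_vector_mul_assoc sym_pos_def_matrix_inv[OF M])
  next
    assume "d * x = l *\<^sub>R (matrix_inv M *v x)"
    then show "M *v (d * x) = l *\<^sub>R x"
      by (simp add: matrix_vector_mult_scaleR matrix_vector_mul_assoc sym_pos_def_matrix_inv[OF M])
  qed
  then show ?thesis
    by (simp add: eigenvector_def matrix_vector_mul_assoc[symmetric] Diag_mult_vec)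
qed

text \<open>Pairing the generalized eigenvalue equation with \<open>x\<close> shows that
  \<open>d \<bullet> (x * x)\<close> is \<open>l\<close> times the energy of \<open>x\<close>. The
  scaled square is therefore the energy-normalized one, and \<open>d\<close> takes the value
  \<open>l\<close> on it.\<close>

lemma eigenvector_in_energy_squares:
  fixes M :: "real^'n^'n"
  assumes M: "sym_pos_def M" and d: "pos_vec d" and x: "eigenvector (M ** Diag d) l x"
  shows "l > 0" and "d \<bullet> (x * x) > 0"
    and "(l / (d \<bullet> (x * x))) *\<^sub>R (x * x) \<in> energy_squares M"
proof -
  have x0: "x \<noteq> 0" and e: "d * x = l *\<^sub>R (matrix_inv M *v x)"
    using x by (simp_all add: eigenvector_Diag_iff[OF M])
  note n = energy_normalize[OF M x0]
  show dx: "d \<bullet> (x * x) > 0" by (rule pos_vec_inner_square_pos[OF d x0])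
  have eq: "d \<bullet> (x * x) = l * (x \<bullet> (matrix_inv M *v x))"
    using e inner_times_vec[of x d] by simp
  show l: "l > 0" using dx n(1) unfolding eq by (simp add: zero_less_mult_iff)
  have "l / (d \<bullet> (x * x)) = 1 / (x \<bullet> (matrix_inv M *v x))"
    using l n(1) by (simp add: eq)
  then show "(l / (d \<bullet> (x * x))) *\<^sub>R (x * x) \<in> energy_squares M" using n(2) by simp
qed

text \<open>Extremality says that the symmetric matrix \<open>Q\<close> below is positive
  semidefinite and that its form vanishes at \<open>p\<close>. Then \<open>Q *v p = 0\<close>, which
  is the generalized eigenvalue equation. The sign \<open>s\<close> is 1 for a maximum and -1 for a
  minimum.\<close>

lemma extremal_eigenvector:
  fixes M :: "real^'n^'n"
  assumes M: "sym_pos_def M" and s: "s \<in> {1, -1}" and p: "p \<bullet> (matrix_inv M *v p) = 1"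
    and ext: "\<And>k. k \<in> energy_squares M \<Longrightarrow> s * (d \<bullet> k) \<le> s * (d \<bullet> (p * p))"
  shows "eigenvector (M ** Diag d) (d \<bullet> (p * p)) p"
proof -
  let ?N = "matrix_inv M"
  define l where "l = d \<bullet> (p * p)"
  define Q where "Q = s *\<^sub>R (l *\<^sub>R ?N - Diag d)"
  have Q: "Q *v x = s *\<^sub>R (l *\<^sub>R (?N *v x) - d * x)" for x
    by (simp add: Q_def matrix_vector_mult_diff_rdistrib scaleR_matrix_vector_assoc[symmetric] Diag_mult_vec)
  have "?N $ i $ j = ?N $ j $ i" for i j
    using sym_pos_def_matrix_inv(3)[OF M] by (simp add: sym_pos_def_def transpose_def vec_eq_iff)
  then have "transpose Q = Q"
    by (simp add: Q_def transpose_def vec_eq_iff Diag_def)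
  moreover have "x \<bullet> (Q *v x) \<ge> 0" for x
  proof (cases "x = 0")
    case False
    note n = energy_normalize[OF M this]
    have "s * (d \<bullet> ((1 / (x \<bullet> (?N *v x))) *\<^sub>R (x * x))) \<le> s * l"
      using ext[OF n(2)] by (simp add: l_def)
    then have "s * (d \<bullet> (x * x)) \<le> s * l * (x \<bullet> (?N *v x))"
      using n(1) by (simp add: field_simps)
    then show ?thesis
      by (simp add: Q inner_diff_right inner_times_vec right_diff_distrib mult.assoc)
  qed simp
  moreover have "p \<bullet> (Q *v p) = 0"
    using p by (simp add: Q inner_diff_right inner_times_vec l_def)
  ultimately have "Q *v p = 0" by (rule psd_quadratic_zero)
  then have "d * p = l *\<^sub>R (?N *v p)" using s by (auto simp: Q)
  moreover have "p \<noteq> 0" using p by auto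
  ultimately show ?thesis by (simp add: eigenvector_Diag_iff[OF M] l_def)
qed

lemma extremal_square_eigenvector:
  assumes M: "sym_pos_def M" and s: "s \<in> {1, -1}" and k: "k \<in> energy_squares M"
    and ext: "\<And>k'. k' \<in> energy_squares M \<Longrightarrow> s * (d \<bullet> k') \<le> s * (d \<bullet> k)"
  obtains x where "k = x * x" "eigenvector (M ** Diag d) (d \<bullet> k) x"
proof -
  obtain p where p: "k = p * p" "p \<bullet> (matrix_inv M *v p) = 1"
    using k unfolding energy_squares_def by blast
  have "eigenvector (M ** Diag d) (d \<bullet> (p * p)) p"
    by (rule extremal_eigenvector[OF M s p(2)]) (use ext in \<open>simp add: p(1)\<close>)
  then show ?thesis by (intro that[of p]) (simp_all add: p(1))
qed

text \<open>Eigenvectors for distinct eigenvalues are orthogonal in the inner product given by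
  \<open>matrix_inv M\<close>, hence independent. Finiteness gives \<open>Max\<close> and
  \<open>Min\<close> in \<open>lambda_max\<close> and \<open>lambda_min\<close> their
  meaning.\<close>

lemma finite_eigenvalues:
  fixes M :: "real^'n^'n"
  assumes M: "sym_pos_def M"
  shows "finite (eigenvalues (M ** Diag d))"
proof -
  let ?N = "matrix_inv M" and ?E = "eigenvalues (M ** Diag d)"
  have symN: "transpose ?N = ?N" using sym_pos_def_matrix_inv(3)[OF M] by (simp add: sym_pos_def_def)
  have "\<forall>l\<in>?E. \<exists>x. eigenvector (M ** Diag d) l x" by (auto simp: eigenvalues_def)
  then obtain X where X: "\<And>l. l \<in> ?E \<Longrightarrow> eigenvector (M ** Diag d) l (X l)"
    using bchoice[of ?E "eigenvector (M ** Diag d)"] by blast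
  have orth: "X l \<bullet> (?N *v X m) = 0" if "l \<in> ?E" "m \<in> ?E" "l \<noteq> m" for l m
  proof -
    have "X l \<bullet> (d * X m) = m * (X l \<bullet> (?N *v X m))" "X m \<bullet> (d * X l) = l * (X m \<bullet> (?N *v X l))"
      using X that by (simp_all add: eigenvector_Diag_iff[OF M])
    moreover have "X l \<bullet> (d * X m) = X m \<bullet> (d * X l)" by (simp add: inner_vec_def mult_ac)
    ultimately show ?thesis using that(3) inner_matrix_vector_sym[OF symN, of "X m" "X l"] by auto
  qed
  have pos: "X l \<bullet> (?N *v X l) > 0" if "l \<in> ?E" for l
    using X[OF that] energy_normalize(1)[OF M] by (simp add: eigenvector_def)
  have inj: "inj_on X ?E"
  proof (rule inj_onI, rule ccontr)
    fix l m assume "l \<in> ?E" "m \<in> ?E" "X l = X m" "l \<noteq> m"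
    then show False using orth[of l m] pos[of l] by simp
  qed
  have "independent (X ` ?E)"
    unfolding dependent_def
  proof clarify
    fix l assume l: "l \<in> ?E" and sp: "X l \<in> span (X ` ?E - {X l})"
    \<comment> \<open>The orthogonal complement of \<open>X l\<close> in that inner product: it
      contains all the other chosen eigenvectors, but not \<open>X l\<close>.\<close>
    let ?S = "{y. X l \<bullet> (?N *v y) = 0}"
    have "subspace ?S"
      by (simp add: subspace_def matrix_vector_right_distrib inner_add_right matrix_vector_mult_scaleR)
    moreover have "X ` ?E - {X l} \<subseteq> ?S" using orth[OF l] by blast
    ultimately have "X l \<in> ?S" using sp span_minimal by blast
    then show False using pos[OF l] by simp
  qed
  then have "finite (X ` ?E)" by (rule independent_imp_finite)
  then show ?thesis using inj by (rule finite_imageD)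
qed

text \<open>Every eigenvalue is a value of \<open>d \<bullet> k\<close> on the compact set
  \<open>energy_squares M\<close>, and the largest and smallest of these values are eigenvalues.
  Later arguments use the extreme eigenvalues only through these facts.\<close>

lemma extremal_eigenvalues:
  fixes M :: "real^'n^'n"
  assumes M: "sym_pos_def M" and d: "pos_vec d"
  shows "\<exists>k\<in>energy_squares M. d \<bullet> k = lambda_max (M ** Diag d)"
    and "\<And>k. k \<in> energy_squares M \<Longrightarrow> d \<bullet> k \<le> lambda_max (M ** Diag d)"
    and "\<exists>k\<in>energy_squares M. d \<bullet> k = lambda_min (M ** Diag d)"
    and "\<And>k. k \<in> energy_squares M \<Longrightarrow> lambda_min (M ** Diag d) \<le> d \<bullet> k"
    and "lambda_min (M ** Diag d) > 0"
    and "lambda_max (M ** Diag d) > 0"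
proof -
  let ?K = "energy_squares M" and ?E = "eigenvalues (M ** Diag d)"
  have cont: "continuous_on ?K ((\<bullet>) d)" by (intro continuous_intros)
  have in_K: "\<exists>k\<in>?K. d \<bullet> k = l" if "l \<in> ?E" for l
  proof -
    obtain x where x: "eigenvector (M ** Diag d) l x" using \<open>l \<in> ?E\<close> by (auto simp: eigenvalues_def)
    note e = eigenvector_in_energy_squares[OF M d x]
    show ?thesis by (rule bexI[OF _ e(3)]) (use e(2) in simp)
  qed
  have ev: "d \<bullet> k \<in> ?E"
    if "s \<in> {1, -1}" "k \<in> ?K" "\<And>k'. k' \<in> ?K \<Longrightarrow> s * (d \<bullet> k') \<le> s * (d \<bullet> k)" for s k
    by (rule extremal_square_eigenvector[OF M that]) (auto simp: eigenvalues_def)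
  obtain p where p: "p \<in> ?K" "\<And>k. k \<in> ?K \<Longrightarrow> d \<bullet> k \<le> d \<bullet> p"
    using continuous_attains_sup[OF compact_energy_squares[OF M] energy_squares_nonempty[OF M] cont] by blast
  have mx: "lambda_max (M ** Diag d) = d \<bullet> p"
    unfolding lambda_max_def
  proof (rule Max_eqI[OF finite_eigenvalues[OF M]])
    show "l \<le> d \<bullet> p" if "l \<in> ?E" for l using in_K[OF that] p(2) by auto
  qed (use ev[of 1 p] p in auto)
  obtain q where q: "q \<in> ?K" "\<And>k. k \<in> ?K \<Longrightarrow> d \<bullet> q \<le> d \<bullet> k"
    using continuous_attains_inf[OF compact_energy_squares[OF M] energy_squares_nonempty[OF M] cont] by blast
  have qE: "d \<bullet> q \<in> ?E" using ev[of "-1" q] q by auto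
  have mn: "lambda_min (M ** Diag d) = d \<bullet> q"
    unfolding lambda_min_def
  proof (rule Min_eqI[OF finite_eigenvalues[OF M]])
    show "d \<bullet> q \<le> l" if "l \<in> ?E" for l using in_K[OF that] q(2) by auto
  qed (rule qE)
  show "\<exists>k\<in>?K. d \<bullet> k = lambda_max (M ** Diag d)" "\<exists>k\<in>?K. d \<bullet> k = lambda_min (M ** Diag d)"
    "k \<in> ?K \<Longrightarrow> d \<bullet> k \<le> lambda_max (M ** Diag d)"
    "k \<in> ?K \<Longrightarrow> lambda_min (M ** Diag d) \<le> d \<bullet> k" for k
    using p q by (auto simp: mx mn)
  show mn0: "lambda_min (M ** Diag d) > 0"
    using qE eigenvector_in_energy_squares(1)[OF M d] by (auto simp: mn eigenvalues_def)
  show "lambda_max (M ** Diag d) > 0"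
    using mn0 p(2)[OF q(1)] by (simp add: mx mn)
qed

section \<open>Danskin's theorem\<close>

text \<open>On a compact set the strict inequality leaves a gap, namely the one at a maximizer
  \<open>k0\<close>. Since the set is bounded, moving \<open>d\<close> by less than the gap divided
  by \<open>B\<close> cannot close it.\<close>

lemma compact_inner_less_nhds:
  fixes S :: "'a::real_inner set"
  assumes S: "compact S" and less: "\<And>k. k \<in> S \<Longrightarrow> d \<bullet> k < m"
  shows "\<forall>\<^sub>F y in nhds d. \<forall>k\<in>S. y \<bullet> k < m"
proof (cases "S = {}")
  case False
  have "continuous_on S ((\<bullet>) d)" by (intro continuous_intros)
  then obtain k0 where k0: "k0 \<in> S" "\<And>k. k \<in> S \<Longrightarrow> d \<bullet> k \<le> d \<bullet> k0"
    using continuous_attains_sup[OF S False] by blast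
  obtain B where B: "B > 0" "\<And>k. k \<in> S \<Longrightarrow> norm k \<le> B"
    using compact_imp_bounded[OF S] unfolding bounded_pos by blast
  have gap: "m - d \<bullet> k0 > 0" using less[OF k0(1)] by simp
  show ?thesis
    unfolding eventually_nhds_metric
  proof (intro exI conjI allI impI ballI)
    show "(m - d \<bullet> k0) / B > 0" using gap B by simp
    fix y k assume y: "dist y d < (m - d \<bullet> k0) / B" and k: "k \<in> S"
    have "(y - d) \<bullet> k \<le> norm (y - d) * norm k" by (rule norm_cauchy_schwarz)
    also have "\<dots> \<le> norm (y - d) * B" using B(2)[OF k] by (simp add: mult_left_mono)
    also have "\<dots> < m - d \<bullet> k0" using y B(1) by (simp add: dist_norm field_simps)
    finally show "y \<bullet> k < m" using k0(2)[OF k] by (simp add: inner_diff_left)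
  qed
qed simp

text \<open>Danskin's theorem for a unique maximizer \<open>p\<close>: maximizers \<open>k\<close>
  at nearby \<open>y\<close> must be close to \<open>p\<close>, and the linearization error lies
  between 0 and \<open>(y - d) \<bullet> (k - p)\<close>. The representation of \<open>f\<close> is
  asked for near \<open>d\<close> only, since for eigenvalues it is established at positive
  vectors.\<close>

lemma GDERIV_support_function:
  fixes f :: "'a::real_inner \<Rightarrow> real"
  assumes K: "compact K"
    and f: "\<forall>\<^sub>F y in nhds d. (\<exists>k\<in>K. y \<bullet> k = f y) \<and> (\<forall>k\<in>K. y \<bullet> k \<le> f y)"
    and p: "p \<in> K" "d \<bullet> p = f d" and uniq: "\<And>k. k \<in> K \<Longrightarrow> d \<bullet> k = f d \<Longrightarrow> k = p"
  shows "GDERIV f d :> p"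
  unfolding gderiv_def has_derivative_at_alt
proof (intro conjI allI impI)
  show "bounded_linear (\<lambda>h. h \<bullet> p)" by (rule bounded_linear_inner_left)
  fix e :: real assume e: "e > 0"
  have fd: "k \<in> K \<Longrightarrow> d \<bullet> k \<le> f d" for k using eventually_nhds_x_imp_x[OF f] by blast
  \<comment> \<open>Differences from \<open>p\<close> to points at distance at least
    \<open>e\<close>. Uniqueness makes \<open>d\<close> strictly negative on them; this persists for
    nearby \<open>y\<close>, so no such point maximizes there.\<close>
  let ?S = "(\<lambda>k. k - p) ` (K \<inter> {k. norm (k - p) \<ge> e})"
  have "compact ?S"
    by (intro compact_continuous_image compact_Int_closed K closed_Collect_le continuous_intros)
  moreover have "d \<bullet> k < 0" if "k \<in> ?S" for k
  proof -
    from that obtain k' where k': "k = k' - p" "k' \<in> K" "norm (k' - p) \<ge> e" by auto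
    then have "d \<bullet> k' \<noteq> f d" using uniq[of k'] e by auto
    then show ?thesis using fd[OF k'(2)] p(2) by (simp add: k'(1) inner_diff_right)
  qed
  ultimately have "\<forall>\<^sub>F y in nhds d. \<forall>k\<in>?S. y \<bullet> k < 0" by (rule compact_inner_less_nhds)
  with f have "\<forall>\<^sub>F y in nhds d. norm (f y - f d - (y - d) \<bullet> p) \<le> e * norm (y - d)"
  proof eventually_elim
    case (elim y)
    obtain k where k: "k \<in> K" "y \<bullet> k = f y" using elim(1) by blast
    have lo: "y \<bullet> p \<le> y \<bullet> k" using elim(1) p(1) k(2) by simp
    have "norm (k - p) < e"
    proof (rule ccontr)
      assume "\<not> norm (k - p) < e"
      then have "y \<bullet> (k - p) < 0" using elim(2) k(1) by auto
      with lo show False by (simp add: inner_diff_right)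
    qed
    have "f y - f d - (y - d) \<bullet> p = y \<bullet> k - y \<bullet> p"
      by (simp add: k(2) p(2)[symmetric] inner_diff_left)
    \<comment> \<open>At \<open>d\<close> the point \<open>p\<close> is at least as good as
      \<open>k\<close>, so the error is bounded by a product of two small differences.\<close>
    moreover have "y \<bullet> k - y \<bullet> p \<le> (y - d) \<bullet> (k - p)"
      using fd[OF k(1)] p(2) by (simp add: inner_diff_left inner_diff_right)
    moreover have "(y - d) \<bullet> (k - p) \<le> norm (y - d) * norm (k - p)" by (rule norm_cauchy_schwarz)
    moreover have "norm (y - d) * norm (k - p) \<le> e * norm (y - d)"
      using \<open>norm (k - p) < e\<close> by (simp add: mult.commute mult_right_mono)
    ultimately show ?case using lo by simp
  qed
  then show "\<exists>r>0. \<forall>y. norm (y - d) < r \<longrightarrow> norm (f y - f d - (y - d) \<bullet> p) \<le> e * norm (y - d)"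
    by (simp add: eventually_nhds_metric dist_norm)
qed

section \<open>The gradient for simple extreme eigenvalues\<close>

lemma simple_eigenvector_collinear:
  assumes m: "multiplicity_of A l = 1" and x: "eigenvector A l x" and y: "eigenvector A l y"
  obtains c where "y = c *\<^sub>R x"
proof -
  let ?S = "{x. A *v x = l *\<^sub>R x}"
  have S: "subspace ?S"
    by (auto simp: subspace_def matrix_vector_right_distrib matrix_vector_mult_scaleR scaleR_add_right)
  have x0: "x \<noteq> 0" "x \<in> ?S" using x by (auto simp: eigenvector_def)
  have "dim (span {x}) = 1" using x0 by (simp add: dim_insert)
  moreover have "span {x} \<subseteq> ?S" using x0(2) S by (simp add: span_minimal)
  ultimately have "span {x} = ?S"
    using m S by (intro subspace_dim_equal) (auto simp: multiplicity_of_def)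
  then have "y \<in> span {x}" using y by (simp add: eigenvector_def)
  with that show ?thesis by (auto simp: span_singleton)
qed

text \<open>Provides the uniqueness needed for Danskin's theorem. An extremal \<open>k\<close> is
  the square of an eigenvector, by simplicity a multiple of \<open>x\<close>, and the value
  \<open>d \<bullet> k = l\<close> determines the squared factor.\<close>

lemma simple_extremal_square_unique:
  fixes M :: "real^'n^'n"
  assumes M: "sym_pos_def M" and d: "pos_vec d" and s: "s \<in> {1, -1}"
    and m: "multiplicity_of (M ** Diag d) l = 1" and x: "eigenvector (M ** Diag d) l x"
    and k: "k \<in> energy_squares M" "d \<bullet> k = l"
    and ext: "\<And>k'. k' \<in> energy_squares M \<Longrightarrow> s * (d \<bullet> k') \<le> s * l"
  shows "k = (l / (d \<bullet> (x * x))) *\<^sub>R (x * x)"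
proof -
  obtain y where "k = y * y" "eigenvector (M ** Diag d) (d \<bullet> k) y"
    by (rule extremal_square_eigenvector[OF M s k(1), of d]) (use ext k(2) in auto)
  then have y: "k = y * y" "eigenvector (M ** Diag d) l y" unfolding k(2) .
  obtain c where c: "y = c *\<^sub>R x" by (rule simple_eigenvector_collinear[OF m x y(2)])
  have kc: "k = c\<^sup>2 *\<^sub>R (x * x)" unfolding y(1) c by (rule scaleR_times_scaleR_vec)
  have "d \<bullet> (x * x) > 0" by (rule eigenvector_in_energy_squares(2)[OF M d x])
  moreover have "c\<^sup>2 * (d \<bullet> (x * x)) = l" using k(2) by (simp add: kc)
  ultimately have "c\<^sup>2 = l / (d \<bullet> (x * x))" by (simp add: field_simps)
  with kc show ?thesis by simp
qed

text \<open>The two inner scaled squares play the role of the gradients of the largest and the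
  smallest eigenvalue. In this form the vector can be compared with the derivative of a
  quotient.\<close>

lemma kappa_grad_quotient_rule:
  fixes M :: "real^'n^'n"
  assumes M: "sym_pos_def M" and d: "pos_vec d"
  shows "kappa_grad M d x1 xn =
    (1 / lambda_min (M ** Diag d)) *\<^sub>R
      ((lambda_max (M ** Diag d) / (d \<bullet> (x1 * x1))) *\<^sub>R (x1 * x1))
    - (lambda_max (M ** Diag d) / (lambda_min (M ** Diag d))\<^sup>2) *\<^sub>R
      ((lambda_min (M ** Diag d) / (d \<bullet> (xn * xn))) *\<^sub>R (xn * xn))"
  using extremal_eigenvalues(5,6)[OF M d]
  by (simp add: kappa_grad_def kappa_def Diag_mult_vec inner_times_vec scaleR_diff_right
      power2_eq_square field_simps)

lemma GDERIV_kappa: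
  fixes M :: "real^'n^'n"
  assumes M: "sym_pos_def M" and d: "pos_vec d" and sm: "smooth_case (M ** Diag d)"
    and x1: "eigenvector (M ** Diag d) (lambda_max (M ** Diag d)) x1"
    and xn: "eigenvector (M ** Diag d) (lambda_min (M ** Diag d)) xn"
  shows "GDERIV (kappa M) d :> kappa_grad M d x1 xn"
proof -
  let ?K = "energy_squares M" and ?h = "\<lambda>y. lambda_max (M ** Diag y)" and ?g = "\<lambda>y. lambda_min (M ** Diag y)"
  define p where "p = (?h d / (d \<bullet> (x1 * x1))) *\<^sub>R (x1 * x1)"
  define q where "q = (?g d / (d \<bullet> (xn * xn))) *\<^sub>R (xn * xn)"
  note e1 = eigenvector_in_energy_squares[OF M d x1] and en = eigenvector_in_energy_squares[OF M d xn]
  have h: "GDERIV ?h d :> p"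
  proof (rule GDERIV_support_function[OF compact_energy_squares[OF M]])
    show "\<forall>\<^sub>F y in nhds d. (\<exists>k\<in>?K. y \<bullet> k = ?h y) \<and> (\<forall>k\<in>?K. y \<bullet> k \<le> ?h y)"
      using eventually_pos_vec[OF d] by eventually_elim (use extremal_eigenvalues(1,2)[OF M] in blast)
    show "p \<in> ?K" "d \<bullet> p = ?h d" using e1 by (simp_all add: p_def)
    show "k = p" if "k \<in> ?K" "d \<bullet> k = ?h d" for k
      unfolding p_def
      by (rule simple_extremal_square_unique[OF M d, of 1])
        (use that sm x1 extremal_eigenvalues(2)[OF M d] in \<open>auto simp: smooth_case_def\<close>)
  qed
  \<comment> \<open>A minimum over \<open>?K\<close> is minus a maximum over the negated set, so
    Danskin's theorem applies to \<open>- ?g\<close>.\<close>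
  have "GDERIV (\<lambda>y. - ?g y) d :> - q"
  proof (rule GDERIV_support_function[of "uminus ` ?K"])
    show "compact (uminus ` ?K)" using compact_energy_squares[OF M] by (rule compact_negations)
    show "\<forall>\<^sub>F y in nhds d. (\<exists>k\<in>uminus ` ?K. y \<bullet> k = - ?g y) \<and> (\<forall>k\<in>uminus ` ?K. y \<bullet> k \<le> - ?g y)"
      using eventually_pos_vec[OF d] by eventually_elim (use extremal_eigenvalues(3,4)[OF M] in auto)
    show "- q \<in> uminus ` ?K" "d \<bullet> - q = - ?g d" using en by (simp_all add: q_def)
    show "k = - q" if k: "k \<in> uminus ` ?K" "d \<bullet> k = - ?g d" for k
    proof -
      have "- k = q"
        unfolding q_def
        by (rule simple_extremal_square_unique[OF M d, of "-1"])
          (use k sm xn extremal_eigenvalues(4)[OF M d] in \<open>auto simp: smooth_case_def\<close>)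
      then show ?thesis by auto
    qed
  qed
  from GDERIV_minus[OF this] have g: "GDERIV ?g d :> q" by simp
  have "?g d \<noteq> 0" using en(1) by simp
  from GDERIV_mult[OF h GDERIV_inverse[OF g this]]
  have "GDERIV (\<lambda>y. ?h y * inverse (?g y)) d :> ?h d *\<^sub>R - (inverse (?g d))\<^sup>2 *\<^sub>R q + inverse (?g d) *\<^sub>R p"
    by simp
  moreover have "(\<lambda>y. ?h y * inverse (?g y)) = kappa M"
    by (simp add: fun_eq_iff kappa_def divide_inverse)
  moreover have "?h d *\<^sub>R - (inverse (?g d))\<^sup>2 *\<^sub>R q + inverse (?g d) *\<^sub>R p = kappa_grad M d x1 xn"
    unfolding kappa_grad_quotient_rule[OF M d] p_def[symmetric] q_def[symmetric]
    by (simp add: field_simps)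
  ultimately show ?thesis by simp
qed

section \<open>The Clarke gradient\<close>

text \<open>The Clarke derivative dominates the one-sided difference quotients at \<open>d\<close> itself, so the
  linear minorant of the maximal eigenvalue and the linear majorant of the minimal one suffice.\<close>

lemma kappa_grad_in_clarke_gradient:
  fixes M :: "real^'n^'n"
  assumes M: "sym_pos_def M" and d: "pos_vec d"
    and x1: "eigenvector (M ** Diag d) (lambda_max (M ** Diag d)) x1"
    and xn: "eigenvector (M ** Diag d) (lambda_min (M ** Diag d)) xn"
  shows "kappa_grad M d x1 xn \<in> clarke_gradient (kappa M) d"
  unfolding clarke_gradient_def
proof (intro CollectI allI)
  fix e :: "real^'n"
  let ?h = "\<lambda>y. lambda_max (M ** Diag y)" and ?g = "\<lambda>y. lambda_min (M ** Diag y)"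
  define p where "p = (?h d / (d \<bullet> (x1 * x1))) *\<^sub>R (x1 * x1)"
  define q where "q = (?g d / (d \<bullet> (xn * xn))) *\<^sub>R (xn * xn)"
  note e1 = eigenvector_in_energy_squares[OF M d x1] and en = eigenvector_in_energy_squares[OF M d xn]
  have p: "p \<in> energy_squares M" "d \<bullet> p = ?h d" using e1 by (simp_all add: p_def)
  have q: "q \<in> energy_squares M" "d \<bullet> q = ?g d" using en by (simp_all add: q_def)
  \<comment> \<open>The difference quotient at \<open>d\<close> in direction \<open>e\<close> of the
    minorant divided by the majorant. By the quotient rule it tends to \<open>?c\<close>.\<close>
  define r where "r t = ((?h d + t * (e \<bullet> p)) / (?g d + t * (e \<bullet> q)) - ?h d / ?g d) / t" for t
  let ?c = "kappa_grad M d x1 xn \<bullet> e"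
  let ?F = "\<lambda>(y, t). ereal ((kappa M (y + t *\<^sub>R e) - kappa M y) / t)"
  have "((\<lambda>t. (?h d + t * (e \<bullet> p)) / (?g d + t * (e \<bullet> q))) has_real_derivative
      (1 / ?g d) * (e \<bullet> p) - (?h d / (?g d)\<^sup>2) * (e \<bullet> q)) (at 0)"
    using en(1) by (auto intro!: derivative_eq_intros simp: field_simps power2_eq_square)
  then have "((\<lambda>t. (?h d + t * (e \<bullet> p)) / (?g d + t * (e \<bullet> q))) has_real_derivative ?c) (at 0)"
    unfolding kappa_grad_quotient_rule[OF M d] p_def[symmetric] q_def[symmetric]
    by (subst inner_commute) (simp add: inner_diff_right)
  then have "(r \<longlongrightarrow> ?c) (at 0)"
    by (simp add: DERIV_def r_def[abs_def])
  then have r: "(r \<longlongrightarrow> ?c) (at_right 0)"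
    by (rule tendsto_mono[OF at_le, rotated]) simp
  have lim: "((\<lambda>t. d + t *\<^sub>R e) \<longlongrightarrow> d) (at_right 0)"
    by (rule tendsto_eq_intros refl | simp)+
  have num: "((\<lambda>t. ?h d + t * (e \<bullet> p)) \<longlongrightarrow> ?h d) (at_right 0)"
    by (rule tendsto_eq_intros refl | simp)+
  \<comment> \<open>For small positive \<open>t\<close> the vector \<open>d + t *\<^sub>R e\<close>
    stays positive and so does the numerator of the comparison quotient, so enlarging the numerator
    and shrinking the denominator can only increase the quotient.\<close>
  have below: "\<forall>\<^sub>F t in at_right 0. r t \<le> (kappa M (d + t *\<^sub>R e) - kappa M d) / t"
    using lim[THEN filterlim_iff[THEN iffD1], rule_format, OF eventually_pos_vec[OF d]]
      order_tendstoD(1)[OF num e1(1)] eventually_at_right_less[of 0]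
  proof eventually_elim
    case (elim t)
    note E = extremal_eigenvalues[OF M elim(1)]
    have "?h d + t * (e \<bullet> p) \<le> ?h (d + t *\<^sub>R e)"
      using E(2)[OF p(1)] p(2) by (simp add: inner_add_left)
    moreover have "?g (d + t *\<^sub>R e) \<le> ?g d + t * (e \<bullet> q)"
      using E(4)[OF q(1)] q(2) by (simp add: inner_add_left)
    ultimately have "(?h d + t * (e \<bullet> p)) / (?g d + t * (e \<bullet> q)) \<le> kappa M (d + t *\<^sub>R e)"
      unfolding kappa_def using E(5) elim(2) by (intro frac_le) auto
    then show ?case
      using elim(3) by (simp add: r_def kappa_def divide_right_mono)
  qed
  show "ereal ?c \<le> clarke_dd (kappa M) d e"
  proof (rule ccontr)
    assume "\<not> ereal ?c \<le> clarke_dd (kappa M) d e"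
    then obtain C where C: "clarke_dd (kappa M) d e < C" "C < ereal ?c"
      using dense not_le by metis
    then have "\<forall>\<^sub>F x in nhds d \<times>\<^sub>F at_right 0. ?F x < C"
      unfolding clarke_dd_def using Limsup_le_iff by blast
    then obtain P Q where PQ: "eventually P (nhds d)" "eventually Q (at_right (0::real))"
      "\<And>y t. P y \<Longrightarrow> Q t \<Longrightarrow> ?F (y, t) < C"
      unfolding eventually_prod_filter by blast
    \<comment> \<open>Every neighbourhood of \<open>d\<close> contains \<open>d\<close>, so the base
      point in the limsup may be fixed at \<open>d\<close>.\<close>
    have "P d" using PQ(1) by (rule eventually_nhds_x_imp_x)
    have "\<forall>\<^sub>F t in at_right 0. C < ereal (r t)"
      using r C(2) by (intro order_tendstoD(1)[of "\<lambda>t. ereal (r t)" "ereal ?c"]) simp_all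
    with PQ(2) below have "\<forall>\<^sub>F t in at_right (0::real). False"
    proof eventually_elim
      case (elim t)
      have "ereal (r t) \<le> ?F (d, t)" using elim(2) by simp
      also have "\<dots> < C" by (rule PQ(3)[OF \<open>P d\<close> elim(1)])
      finally show False using elim(3) by simp
    qed
    then show False by (simp add: trivial_limit_at_right_real)
  qed
qed

section \<open>Optimality of the all-ones vector\<close>

text \<open>Where \<open>v \<bullet> k > 0\<close>, any positive \<open>t\<close> pushes the value
  below \<open>m\<close>. The remaining points form a compact set that contains no maximizer, so
  there the strict inequality survives a small perturbation of \<open>c\<close>.\<close>

lemma eventually_descent_direction:
  fixes K :: "'a::real_inner set"
  assumes K: "compact K" and le: "\<And>k. k \<in> K \<Longrightarrow> c \<bullet> k \<le> m"
    and v: "\<And>k. k \<in> K \<Longrightarrow> c \<bullet> k = m \<Longrightarrow> v \<bullet> k > 0"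
  shows "\<forall>\<^sub>F t in at_right (0::real). \<forall>k\<in>K. (c - t *\<^sub>R v) \<bullet> k < m"
proof -
  let ?S = "K \<inter> {k. v \<bullet> k \<le> 0}"
  have "compact ?S" by (intro compact_Int_closed K closed_Collect_le continuous_intros)
  moreover have "c \<bullet> k < m" if "k \<in> ?S" for k
    using le[of k] v[of k] that by fastforce
  ultimately have ev: "\<forall>\<^sub>F y in nhds c. \<forall>k\<in>?S. y \<bullet> k < m" by (rule compact_inner_less_nhds)
  have "((\<lambda>t. c - t *\<^sub>R v) \<longlongrightarrow> c) (at_right 0)"
    by (rule tendsto_eq_intros refl | simp)+
  from this[THEN filterlim_iff[THEN iffD1], rule_format, OF ev] eventually_at_right_less[of 0]
  show ?thesis
  proof eventually_elim
    case (elim t)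
    show ?case
    proof
      fix k assume k: "k \<in> K"
      show "(c - t *\<^sub>R v) \<bullet> k < m"
      proof (cases "v \<bullet> k \<le> 0")
        case False
        then have "t * (v \<bullet> k) > 0" using elim(2) by simp
        then show ?thesis using le[OF k] by (simp add: inner_diff_left)
      qed (use elim(1) k in auto)
    qed
  qed
qed

lemma compact_eigen_squares: "compact (eigen_squares A l)"
proof -
  let ?S = "{x. A *v x = l *\<^sub>R x} \<inter> sphere 0 1"
  have "closed {x. A *v x = l *\<^sub>R x}"
    by (intro closed_Collect_eq continuous_intros matrix_vector_mult_linear_continuous_on)
  then have "compact ((\<lambda>x. x * x) ` ?S)"
    by (intro compact_continuous_image continuous_on_times_vec closed_Int_compact compact_sphere)
  moreover have "eigen_squares A l = (\<lambda>x. x * x) ` ?S"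
    by (auto simp: eigen_squares_def unit_eigenvector_def eigenvector_def image_def)
  ultimately show ?thesis by simp
qed

text \<open>Links the two normalizations: a unit eigenvector of \<open>M\<close> for
  \<open>l\<close> has energy \<open>1 / l\<close>, so its square is scaled by
  \<open>l\<close>.\<close>

lemma scaleR_eigen_squares_in_energy_squares:
  fixes M :: "real^'n^'n"
  assumes M: "sym_pos_def M" and e: "e \<in> eigen_squares M l"
  shows "l *\<^sub>R e \<in> energy_squares M" "1 \<bullet> e = 1"
proof -
  obtain x where x: "e = x * x" "eigenvector (M ** Diag 1) l x" "norm x = 1"
    using e by (auto simp: eigen_squares_def unit_eigenvector_def Diag_one)
  show "1 \<bullet> e = 1" by (simp add: x inner_one_square)
  then show "l *\<^sub>R e \<in> energy_squares M"
    using eigenvector_in_energy_squares(3)[OF M pos_vec_one x(2)] by (simp add: x(1))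
qed

text \<open>Conversely, an extremal \<open>k\<close> is the square of an eigenvector of squared norm
  \<open>l\<close>, because its coordinates sum to \<open>l\<close>.\<close>

lemma extremal_in_scaleR_eigen_squares:
  fixes M :: "real^'n^'n"
  assumes M: "sym_pos_def M" and s: "s \<in> {1, -1}" and k: "k \<in> energy_squares M" "1 \<bullet> k = l"
    and ext: "\<And>k'. k' \<in> energy_squares M \<Longrightarrow> s * (1 \<bullet> k') \<le> s * l"
  shows "l > 0" "(1 / l) *\<^sub>R k \<in> eigen_squares M l"
proof -
  obtain x where "k = x * x" "eigenvector (M ** Diag 1) (1 \<bullet> k) x"
    by (rule extremal_square_eigenvector[OF M s k(1), of 1]) (use ext k(2) in auto)
  then have x: "k = x * x" "eigenvector (M ** Diag 1) l x" unfolding k(2) .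
  show l: "l > 0" by (rule eigenvector_in_energy_squares(1)[OF M pos_vec_one x(2)])
  have nx: "(norm x)\<^sup>2 = l" using k(2) by (simp add: x(1) inner_one_square)
  let ?y = "(1 / norm x) *\<^sub>R x"
  have "unit_eigenvector M l ?y"
    using x(2) by (simp add: unit_eigenvector_def eigenvector_def Diag_one matrix_vector_mult_scaleR)
  moreover have "(1 / l) *\<^sub>R k = ?y * ?y"
    unfolding scaleR_times_scaleR_vec by (simp add: x(1) nx power_divide)
  ultimately show "(1 / l) *\<^sub>R k \<in> eigen_squares M l"
    unfolding eigen_squares_def by blast
qed

text \<open>For each positive \<open>d\<close>, the bounds on \<open>d \<bullet> k\<close> over
  \<open>energy_squares M\<close> place each set of squares in a halfspace, which then contains the
  hull too. At the common point \<open>w\<close> the two bounds chain to the global inequality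
  between the condition numbers.\<close>

lemma kappa_optimal_if_hulls_meet:
  fixes M :: "real^'n^'n"
  assumes M: "sym_pos_def M"
    and w1: "w \<in> convex hull eigen_squares M (lambda_max M)"
    and wn: "w \<in> convex hull eigen_squares M (lambda_min M)"
  shows "kappa_optimal M"
proof -
  have "kappa M 1 \<le> kappa M d" if d: "pos_vec d" for d
  proof -
    let ?h = "\<lambda>y. lambda_max (M ** Diag y)" and ?g = "\<lambda>y. lambda_min (M ** Diag y)"
    note E = extremal_eigenvalues[OF M d] and E1 = extremal_eigenvalues[OF M pos_vec_one]
    have "convex hull eigen_squares M (lambda_max M) \<subseteq> {w. d \<bullet> w \<le> ?h d / ?h 1}"
    proof (rule hull_minimal)
      show "eigen_squares M (lambda_max M) \<subseteq> {w. d \<bullet> w \<le> ?h d / ?h 1}"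
        using scaleR_eigen_squares_in_energy_squares(1)[OF M, THEN E(2)] E1(6)
        by (auto simp: Diag_one field_simps)
    qed (rule convex_halfspace_le)
    then have "d \<bullet> w \<le> ?h d / ?h 1" using w1 by blast
    moreover have "convex hull eigen_squares M (lambda_min M) \<subseteq> {w. d \<bullet> w \<ge> ?g d / ?g 1}"
    proof (rule hull_minimal)
      show "eigen_squares M (lambda_min M) \<subseteq> {w. d \<bullet> w \<ge> ?g d / ?g 1}"
        using scaleR_eigen_squares_in_energy_squares(1)[OF M, THEN E(4)] E1(5)
        by (auto simp: Diag_one field_simps)
    qed (rule convex_halfspace_ge)
    then have "?g d / ?g 1 \<le> d \<bullet> w" using wn by blast
    ultimately have "?g d / ?g 1 \<le> ?h d / ?h 1" by simp
    then show ?thesis using E(5,6) E1(5,6) by (simp add: kappa_def field_simps)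
  qed
  then show ?thesis
    unfolding kappa_optimal_def is_arg_min_def using pos_vec_one by (auto simp: not_less)
qed

text \<open>A hyperplane separating the two hulls gives a direction that lowers the maximal eigenvalue
  and raises the minimal one. As both hulls lie in the plane where the coordinates sum to 1, it can
  be taken through the origin.\<close>

lemma hulls_meet_if_kappa_optimal:
  fixes M :: "real^'n^'n"
  assumes M: "sym_pos_def M" and opt: "kappa_optimal M"
  shows "convex hull eigen_squares M (lambda_max M) \<inter> convex hull eigen_squares M (lambda_min M) \<noteq> {}"
    (is "?A \<inter> ?B \<noteq> {}")
proof
  assume disj: "?A \<inter> ?B = {}"
  let ?K = "energy_squares M"
  let ?h = "\<lambda>y. lambda_max (M ** Diag y)" and ?g = "\<lambda>y. lambda_min (M ** Diag y)"
  note E1 = extremal_eigenvalues[OF M pos_vec_one]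
  \<comment> \<open>Extremal points at the all-ones vector are positive multiples of squared unit
    eigenvectors, so the separating hyperplane decides the sign of \<open>v\<close> on them.\<close>
  have top: "(1 / ?h 1) *\<^sub>R k \<in> eigen_squares M (?h 1)" if "k \<in> ?K" "1 \<bullet> k = ?h 1" for k
    by (rule extremal_in_scaleR_eigen_squares(2)[OF M, of 1]) (use that E1(2) in auto)
  have bot: "(1 / ?g 1) *\<^sub>R k \<in> eigen_squares M (?g 1)" if "k \<in> ?K" "1 \<bullet> k = ?g 1" for k
    by (rule extremal_in_scaleR_eigen_squares(2)[OF M, of "-1"]) (use that E1(4) in auto)
  have "?A \<noteq> {}" "?B \<noteq> {}" using top bot E1(1,3) by (auto simp: Diag_one)
  moreover have "compact ?A" "compact ?B"
    by (simp_all add: compact_convex_hull compact_eigen_squares)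
  moreover have "?B \<inter> ?A = {}" using disj by blast
  ultimately obtain a b where ab: "\<And>x. x \<in> ?B \<Longrightarrow> a \<bullet> x < b" "\<And>x. x \<in> ?A \<Longrightarrow> b < a \<bullet> x"
    using separating_hyperplane_compact_closed[of ?B ?A]
    by (metis compact_imp_closed convex_convex_hull)
  define v where "v = a - b *\<^sub>R 1"
  have v: "v \<bullet> e = a \<bullet> e - b" if "e \<in> eigen_squares M l" for e l
    using scaleR_eigen_squares_in_energy_squares(2)[OF M that] by (simp add: v_def inner_diff_left)
  have "v \<bullet> k > 0" if k: "k \<in> ?K" "1 \<bullet> k = ?h 1" for k
  proof -
    have "(1 / ?h 1) * (v \<bullet> k) > 0"
      using v[OF top[OF k]] ab(2)[OF hull_inc[OF top[OF k, unfolded Diag_one]]] by (simp add: Diag_one)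
    then show ?thesis using E1(6) by (simp add: zero_less_divide_iff)
  qed
  then have "\<forall>\<^sub>F t in at_right (0::real). \<forall>k\<in>?K. (1 - t *\<^sub>R v) \<bullet> k < ?h 1"
    using E1(2) by (intro eventually_descent_direction compact_energy_squares M)
  \<comment> \<open>On the negated set the minimum becomes a maximum, so the same direction serves
    as a descent direction there.\<close>
  moreover have "\<forall>\<^sub>F t in at_right (0::real). \<forall>k\<in>uminus ` ?K. (1 - t *\<^sub>R v) \<bullet> k < - ?g 1"
  proof (intro eventually_descent_direction)
    show "compact (uminus ` ?K)" by (intro compact_negations compact_energy_squares M)
    show "1 \<bullet> k \<le> - ?g 1" if "k \<in> uminus ` ?K" for k using E1(4) that by auto
    show "v \<bullet> k > 0" if "k \<in> uminus ` ?K" "1 \<bullet> k = - ?g 1" for k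
    proof -
      from that have k: "- k \<in> ?K" "1 \<bullet> - k = ?g 1" by auto
      have "(1 / ?g 1) * (v \<bullet> k) > 0"
        using v[OF bot[OF k]] ab(1)[OF hull_inc[OF bot[OF k, unfolded Diag_one]]] by (simp add: Diag_one)
      then show ?thesis using E1(5) by (simp add: zero_less_divide_iff)
    qed
  qed
  moreover have "\<forall>\<^sub>F t in at_right (0::real). pos_vec (1 - t *\<^sub>R v)"
  proof -
    have "((\<lambda>t. 1 - t *\<^sub>R v) \<longlongrightarrow> 1) (at_right 0)"
      by (rule tendsto_eq_intros refl | simp)+
    from this[THEN filterlim_iff[THEN iffD1], rule_format, OF eventually_pos_vec[OF pos_vec_one]]
    show ?thesis .
  qed
  ultimately have "\<forall>\<^sub>F t in at_right (0::real). \<exists>y. pos_vec y \<and> kappa M y < kappa M 1"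
  proof eventually_elim
    case (elim t)
    let ?y = "1 - t *\<^sub>R v"
    note E = extremal_eigenvalues[OF M elim(3)]
    \<comment> \<open>Both extreme values at \<open>?y\<close> are attained, so the strict bounds
      valid for all \<open>k\<close> pass to them.\<close>
    have "?h ?y < ?h 1" using E(1) elim(1) by metis
    moreover have "?g 1 < ?g ?y" using E(3) elim(2) by fastforce
    ultimately have "kappa M ?y < kappa M 1"
      unfolding kappa_def using E1(5,6) E(6) by (intro frac_less) auto
    with elim(3) show ?case by blast
  qed
  then have "\<exists>y. pos_vec y \<and> kappa M y < kappa M 1"
    by (simp add: trivial_limit_at_right_real)
  with opt show False by (auto simp: kappa_optimal_def is_arg_min_def)
qed

lemma kappa_optimal_iff_hulls_meet:
  assumes "sym_pos_def M"
  shows "kappa_optimal M \<longleftrightarrow>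
    convex hull eigen_squares M (lambda_max M) \<inter> convex hull eigen_squares M (lambda_min M) \<noteq> {}"
  using kappa_optimal_if_hulls_meet[OF assms] hulls_meet_if_kappa_optimal[OF assms] by blast

section \<open>Simple eigenvalues, orthogonality and sign patterns\<close>

text \<open>A unit eigenvector for a simple eigenvalue is unique up to sign, which squaring removes.
  Each hull is then a single point.\<close>

lemma simple_eigen_squares:
  assumes m: "multiplicity_of A l = 1" and x: "unit_eigenvector A l x"
  shows "eigen_squares A l = {x * x}"
proof -
  have "y * y = x * x" if "unit_eigenvector A l y" for y
  proof -
    have "eigenvector A l x" "eigenvector A l y" using x that by (auto simp: unit_eigenvector_def)
    then obtain c where c: "y = c *\<^sub>R x" by (rule simple_eigenvector_collinear[OF m])
    then have "\<bar>c\<bar> = 1" using x that by (simp add: unit_eigenvector_def)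
    then have "c\<^sup>2 = 1" by (simp add: abs_square_eq_1)
    then show ?thesis unfolding c scaleR_times_scaleR_vec by simp
  qed
  with x show ?thesis unfolding eigen_squares_def by blast
qed

text \<open>Distinct eigenvalues of a symmetric matrix have orthogonal eigenvectors. If the extreme
  eigenvalues coincided, every nonzero vector would be extremal after normalization, hence an
  eigenvector, and the multiplicity would be the dimension. In dimension one this is no
  contradiction and orthogonality fails.\<close>

lemma smooth_case_orthogonal:
  fixes M :: "real^'n^'n"
  assumes M: "sym_pos_def M" and sm: "smooth_case M" and n: "CARD('n) \<ge> 2"
    and x1: "eigenvector M (lambda_max M) x1" and xn: "eigenvector M (lambda_min M) xn"
  shows "x1 \<bullet> xn = 0"
proof -
  note E = extremal_eigenvalues[OF M pos_vec_one, unfolded Diag_one]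
  have ne: "lambda_max M \<noteq> lambda_min M"
  proof
    assume eq: "lambda_max M = lambda_min M"
    have "M *v x = lambda_max M *\<^sub>R x" for x
    proof (cases "x = 0")
      case False
      define c where "c = 1 / sqrt (x \<bullet> (matrix_inv M *v x))"
      note pos = energy_normalize(1)[OF M False]
      have c: "c\<^sup>2 = 1 / (x \<bullet> (matrix_inv M *v x))" "c \<noteq> 0"
        using pos by (simp_all add: c_def power_divide)
      define p where "p = c *\<^sub>R x"
      have "p \<bullet> (matrix_inv M *v p) = c\<^sup>2 * (x \<bullet> (matrix_inv M *v x))"
        by (simp add: p_def matrix_vector_mult_scaleR power2_eq_square)
      also have "\<dots> = 1" using pos by (simp add: c)
      finally have p: "p \<bullet> (matrix_inv M *v p) = 1" .
      \<comment> \<open>With equal extremes, the coordinate sum is constant on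
        \<open>energy_squares M\<close>, so each of its points is a maximizer.\<close>
      have one: "1 \<bullet> k = lambda_max M" if "k \<in> energy_squares M" for k
        using E(2)[OF that] E(4)[OF that] eq by simp
      have pK: "p * p \<in> energy_squares M" unfolding energy_squares_def using p by blast
      have "eigenvector (M ** Diag 1) (1 \<bullet> (p * p)) p"
        by (rule extremal_eigenvector[OF M _ p, of 1]) (simp_all add: one one[OF pK])
      then have "M *v p = lambda_max M *\<^sub>R p"
        by (simp add: Diag_one eigenvector_def one[OF pK])
      then have "c *\<^sub>R (M *v x) = c *\<^sub>R (lambda_max M *\<^sub>R x)"
        by (simp add: p_def matrix_vector_mult_scaleR mult.commute)
      then show ?thesis by (rule scaleR_left_imp_eq[OF c(2)])
    qed simp
    then have "multiplicity_of M (lambda_max M) = dim (UNIV :: (real^'n) set)"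
      by (simp add: multiplicity_of_def)
    then show False using sm n by (simp add: smooth_case_def dim_UNIV)
  qed
  have sym: "transpose M = M" using M by (simp add: sym_pos_def_def)
  have "x1 \<bullet> (M *v xn) = lambda_min M * (x1 \<bullet> xn)" "xn \<bullet> (M *v x1) = lambda_max M * (xn \<bullet> x1)"
    using x1 xn by (simp_all add: eigenvector_def)
  then show ?thesis
    using inner_matrix_vector_sym[OF sym, of x1 xn] ne by (simp add: inner_commute)
qed

text \<open>Equal squares mean that the coordinates agree up to sign. Listing those that agree first
  gives the two blocks, and \<open>x \<bullet> y\<close> is the difference of their squared norms,
  so orthogonality makes the norms equal.\<close>

lemma squares_eq_iff_sign_block_form:
  fixes x y :: "real^'n"
  assumes orth: "x \<bullet> y = 0"
  shows "x * x = y * y \<longleftrightarrow> sign_block_form x y"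
proof
  assume eq: "x * x = y * y"
  \<comment> \<open>Coordinates where both vectors vanish fit either block and are put into the
    first.\<close>
  define A where "A = {i. y $ i = x $ i}"
  have same: "y $ i = x $ i" if "i \<in> A" for i using that by (simp add: A_def)
  have sgn: "y $ i = - x $ i" if "i \<notin> A" for i
  proof -
    have "(x * x) $ i = (y * y) $ i" unfolding eq ..
    then have "x $ i * x $ i = y $ i * y $ i" by (simp only: vector_mult_component)
    then have "x $ i = y $ i \<or> x $ i = - y $ i" by (simp only: square_eq_iff)
    with that show ?thesis by (auto simp: A_def)
  qed
  obtain as where as: "set as = A" "distinct as" using finite_distinct_list[of A] by auto
  obtain bs where bs: "set bs = - A" "distinct bs" using finite_distinct_list[of "- A"] by auto
  have norm_list: "(\<Sum>t\<leftarrow>map (($) x) is. t\<^sup>2) = (\<Sum>i\<in>set is. (x $ i)\<^sup>2)" if "distinct is" for "is"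
    using that by (simp add: sum_list_distinct_conv_sum_set o_def)
  have "x \<bullet> y = (\<Sum>i\<in>- A. x $ i * y $ i) + (\<Sum>i\<in>A. x $ i * y $ i)"
    unfolding inner_vec_def inner_real_def Compl_eq_Diff_UNIV by (rule sum.subset_diff) simp_all
  also have "(\<Sum>i\<in>A. x $ i * y $ i) = (\<Sum>i\<in>A. (x $ i)\<^sup>2)"
    by (rule sum.cong) (simp_all add: same power2_eq_square)
  also have "(\<Sum>i\<in>- A. x $ i * y $ i) = - (\<Sum>i\<in>- A. (x $ i)\<^sup>2)"
    unfolding sum_negf[symmetric] by (rule sum.cong) (simp_all add: sgn power2_eq_square)
  finally have "(\<Sum>i\<in>A. (x $ i)\<^sup>2) = (\<Sum>i\<in>- A. (x $ i)\<^sup>2)" using orth by simp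
  then have "list_norm (map (($) x) as) = list_norm (map (($) x) bs)"
    using norm_list[OF as(2)] norm_list[OF bs(2)] as(1) bs(1) by (simp add: list_norm_def)
  moreover have "distinct (as @ bs)" "set (as @ bs) = UNIV" using as bs by auto
  moreover have "map (($) y) (as @ bs) = map (($) x) as @ map uminus (map (($) x) bs)"
    using as(1) bs(1) sgn same by simp
  ultimately show "sign_block_form x y"
    unfolding sign_block_form_def
    by (intro exI[of _ "as @ bs"] exI[of _ "map (($) x) as"] exI[of _ "map (($) x) bs"] conjI) simp_all
next
  assume "sign_block_form x y"
  then obtain "is" u v where s: "set is = UNIV"
    "map (($) x) is = u @ v" "map (($) y) is = u @ map uminus v"
    unfolding sign_block_form_def by blast
  have "map (\<lambda>i. x $ i * x $ i) is = map (\<lambda>t. t * t) (map (($) x) is)" by simp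
  also have "\<dots> = map (\<lambda>t. t * t) (map (($) y) is)" unfolding s by simp
  finally have "map (\<lambda>i. x $ i * x $ i) is = map (\<lambda>i. y $ i * y $ i) is" by (simp add: o_def)
  then show "x * x = y * y"
    using s(1) by (simp add: vec_eq_iff)
qed

theorem theorem2p7:
  fixes M :: "real^'n^'n" and d :: "real^'n"
  assumes "sym_pos_def M" and "pos_vec d"
  shows
    "(smooth_case (M ** Diag d) \<longrightarrow>
       (\<forall>x1 xn. eigenvector (M ** Diag d) (lambda_max (M ** Diag d)) x1 \<longrightarrow>
                eigenvector (M ** Diag d) (lambda_min (M ** Diag d)) xn \<longrightarrow>
          GDERIV (kappa M) d :> kappa_grad M d x1 xn))
   \<and> (smooth_case M \<longrightarrow>
       (\<forall>x1 xn. unit_eigenvector M (lambda_max M) x1 \<longrightarrow> unit_eigenvector M (lambda_min M) xn \<longrightarrow>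
          (CARD('n) \<ge> 2 \<longrightarrow> x1 \<bullet> xn = 0) \<and>
          (kappa_optimal M \<longleftrightarrow> x1 * x1 = xn * xn)))
   \<and> (\<forall>x1 xn. unit_eigenvector M (lambda_max M) x1 \<longrightarrow> unit_eigenvector M (lambda_min M) xn \<longrightarrow>
          x1 \<bullet> xn = 0 \<longrightarrow>
          (x1 * x1 = xn * xn \<longleftrightarrow> sign_block_form x1 xn))
   \<and> (\<not> smooth_case (M ** Diag d) \<longrightarrow>
       (\<forall>x1 xn. eigenvector (M ** Diag d) (lambda_max (M ** Diag d)) x1 \<longrightarrow>
                eigenvector (M ** Diag d) (lambda_min (M ** Diag d)) xn \<longrightarrow>
          kappa_grad M d x1 xn \<in> clarke_gradient (kappa M) d))
   \<and> (\<not> smooth_case M \<longrightarrow>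
       (\<forall>x1 xn. unit_eigenvector M (lambda_max M) x1 \<longrightarrow> unit_eigenvector M (lambda_min M) xn \<longrightarrow>
          x1 * x1 = xn * xn \<longrightarrow> kappa_optimal M) \<and>
       (kappa_optimal M \<longleftrightarrow>
          convex hull eigen_squares M (lambda_max M) \<inter> convex hull eigen_squares M (lambda_min M) \<noteq> {}))"
proof (intro conjI impI allI)
  fix x1 xn :: "real^'n"
  assume "unit_eigenvector M (lambda_max M) x1" "unit_eigenvector M (lambda_min M) xn"
    and eq: "x1 * x1 = xn * xn"
  then have "x1 * x1 \<in> eigen_squares M (lambda_max M)" "xn * xn \<in> eigen_squares M (lambda_min M)"
    unfolding eigen_squares_def by blast+
  then show "kappa_optimal M"
    using eq by (intro kappa_optimal_if_hulls_meet[OF assms(1), of "x1 * x1"] hull_inc) simp_all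
next
  fix x1 xn :: "real^'n"
  assume sm: "smooth_case M" and x: "unit_eigenvector M (lambda_max M) x1" "unit_eigenvector M (lambda_min M) xn"
  show "x1 \<bullet> xn = 0" if "CARD('n) \<ge> 2"
    using smooth_case_orthogonal[OF assms(1) sm that] x by (simp add: unit_eigenvector_def)
  \<comment> \<open>Both hulls are singletons here, so they meet exactly when the two squares are
    equal.\<close>
  show "kappa_optimal M \<longleftrightarrow> x1 * x1 = xn * xn"
    using sm x
    by (auto simp: kappa_optimal_iff_hulls_meet[OF assms(1)] simple_eigen_squares smooth_case_def)
qed (use assms GDERIV_kappa kappa_grad_in_clarke_gradient squares_eq_iff_sign_block_form
    kappa_optimal_iff_hulls_meet in blast)+

end
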